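(* Let $G$ be a simple connected graph, let $V(G)=\{t_1,\dots,t_n\}$, let $\mathbb{K}$ be a field, and let $\mathcal{N}_G\subseteq S=\mathbb{K}[t_1,\dots,t_n]$ be the closed neighborhood ideal of $G$. Then $$\gamma(G)\le \mathtt{v}(\mathcal{N}_G)\le \tau(G).$$
   Context: Graphs are finite and simple (no loops or multiple edges). A graph is connected if for every pair of vertices there is a path between them. The vertices of $G$ are identified with the variables $t_1,\dots,t_n$ of $S=\mathbb{K}[t_1,\dots,t_n]=\bigoplus_{d\ge 0}S_d$ (standard grading). For a vertex $v$, $\mathtt{N}[v]$ is the set consisting of $v$ and all its neighbors; for $D\subseteq V(G)$, $\mathtt{N}[D]=\bigcup_{v\in D}\mathtt{N}[v]$. A dominating set is a set $D\subseteq V(G)$ with $\mathtt{N}[D]=V(G)$; the domination number $\gamma(G)$ is the minimum cardinality of a dominating set. A vertex cover is a set of vertices such that every edge is incident with at least one of them; the vertex cover number $\tau(G)$ is the minimum cardinality of a vertex cover. For $A\subseteq V(G)$, $\mathbf{t}_A=\prod_{t_j\in A}t_j$. The closed neighborhood ideal of $G$ is $\mathcal{N}_G=\langle \mathbf{t}_{\mathtt{N}[t_i]} : t_i\in V(G)\rangle\subseteq S$. For a graded ideal $I\subseteq S$, $(I:f)=\{g\in S : gf\in I\}$, $\operatorname{Ass}(I)$ is the set of associated primes of $S/I$, and the $\mathtt{v}$-number of $I$ is $$\mathtt{v}(I)=\min\{d\ge 0 : \exists\, f\in S_d \text{ and } \mathfrak{p}\in\operatorname{Ass}(I)\text{ with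 }(I:f)=\mathfrak{p}\}.$$
   Formalization: The graph G is assumed to have at least two vertices; for the one-vertex graph the stated inequality fails, since there the domination number is 1 while the v-number and the vertex cover number are both 0. *)

theory Defs
  imports "HOL-Algebra.QuotRing" "HOL-Library.Poly_Mapping"
begin

text \<open>
  A graph is given by its adjacency relation; its vertex set is the whole finite type \<open>'v\<close>,
  whose elements also index the variables of the polynomial ring.
\<close>

definition simple_graph :: "('v \<Rightarrow> 'v \<Rightarrow> bool) \<Rightarrow> bool" where
  "simple_graph E \<longleftrightarrow> symp E \<and> irreflp E"

definition connected_graph :: "('v \<Rightarrow> 'v \<Rightarrow> bool) \<Rightarrow> bool" where
  "connected_graph E \<longleftrightarrow> (\<forall>u v. E\<^sup>*\<^sup>* u v)"

definition closed_nbhd :: "('v \<Rightarrow> 'v \<Rightarrow> bool) \<Rightarrow> 'v \<Rightarrow> 'v set" where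
  "closed_nbhd E v = insert v {w. E v w}"

definition dominating_set :: "('v \<Rightarrow> 'v \<Rightarrow> bool) \<Rightarrow> 'v set \<Rightarrow> bool" where
  "dominating_set E D \<longleftrightarrow> (\<Union>v\<in>D. closed_nbhd E v) = UNIV"

definition domination_number :: "('v::finite \<Rightarrow> 'v \<Rightarrow> bool) \<Rightarrow> nat" where
  "domination_number E = Min {card D | D. dominating_set E D}"

definition vertex_cover :: "('v \<Rightarrow> 'v \<Rightarrow> bool) \<Rightarrow> 'v set \<Rightarrow> bool" where
  "vertex_cover E C \<longleftrightarrow> (\<forall>u v. E u v \<longrightarrow> u \<in> C \<or> v \<in> C)"

definition vertex_cover_number :: "('v::finite \<Rightarrow> 'v \<Rightarrow> bool) \<Rightarrow> nat" where
  "vertex_cover_number E = Min {card C | C. vertex_cover E C}"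

text \<open>
  A polynomial is a finitely supported map from monomials to coefficients, a monomial being a
  finitely supported map from variables to exponents.  The type carries the ring operations;
  \<open>poly_ring\<close> packages them as a ring in the sense of HOL-Algebra.
\<close>

type_synonym ('v, 'k) mpoly = "('v \<Rightarrow>\<^sub>0 nat) \<Rightarrow>\<^sub>0 'k"

definition poly_ring :: "('v, 'k::field) mpoly ring" where
  "poly_ring = \<lparr>carrier = UNIV, mult = (*), one = 1, zero = 0, add = (+)\<rparr>"

definition var :: "'v \<Rightarrow> ('v, 'k::field) mpoly" where
  "var v = Poly_Mapping.single (Poly_Mapping.single v 1) 1"

definition var_prod :: "'v set \<Rightarrow> ('v, 'k::field) mpoly" where
  "var_prod A = (\<Prod>v\<in>A. var v)"

definition homogeneous_part :: "nat \<Rightarrow> ('v::finite, 'k::field) mpoly set" where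
  "homogeneous_part d =
     {f. \<forall>m\<in>Poly_Mapping.keys f. (\<Sum>v\<in>UNIV. Poly_Mapping.lookup m v) = d}"

definition closed_nbhd_ideal :: "('v::finite \<Rightarrow> 'v \<Rightarrow> bool) \<Rightarrow> ('v, 'k::field) mpoly set" where
  "closed_nbhd_ideal E = Idl\<^bsub>poly_ring\<^esub> (range (\<lambda>v. var_prod (closed_nbhd E v)))"

definition colon_ideal :: "('a, 'b) ring_scheme \<Rightarrow> 'a set \<Rightarrow> 'a \<Rightarrow> 'a set" where
  "colon_ideal R I f = {g \<in> carrier R. g \<otimes>\<^bsub>R\<^esub> f \<in> I}"

text \<open>
  The associated primes of the \<open>R\<close>-module \<open>R / I\<close>: the prime ideals that are annihilators of
  elements of \<open>R / I\<close>, where \<open>r\<close> acts as multiplication by its residue class \<open>I + r\<close>.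
\<close>

definition associated_primes :: "('a, 'b) ring_scheme \<Rightarrow> 'a set \<Rightarrow> 'a set set" where
  "associated_primes R I =
     {P. primeideal P R \<and>
         (\<exists>x\<in>carrier (R Quot I).
            P = {r \<in> carrier R. (I +>\<^bsub>R\<^esub> r) \<otimes>\<^bsub>R Quot I\<^esub> x = \<zero>\<^bsub>R Quot I\<^esub>})}"

text \<open>
  The infimum in \<open>nat\<close> of a nonempty set is its minimum, while \<open>Inf {} = 0\<close>.  As domination
  numbers are positive, a lower bound \<open>domination_number E \<le> v_number I\<close> also asserts that the
  set is nonempty.
\<close>

definition v_number :: "('v::finite, 'k::field) mpoly set \<Rightarrow> nat" where
  "v_number I = Inf {d. \<exists>f \<in> homogeneous_part d. \<exists>P \<in> associated_primes poly_ring I.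
     colon_ideal poly_ring I f = P}"

text \<open>
  The one-vertex graph has \<open>domination_number = 1\<close> but \<open>v_number = vertex_cover_number = 0\<close>
  (its closed neighborhood ideal is generated by the single variable, hence prime), so results
  bounding \<open>v_number\<close> below by \<open>domination_number\<close> require at least two vertices.
\<close>

end

theory Submission imports Defs begin

text \<open>
  Membership in the closed neighborhood ideal \<open>I\<close> is decided monomial by monomial: a polynomial
  lies in \<open>I\<close> iff the support of each of its monomials contains some \<open>N[v]\<close>
  (\<open>Idl_var_prod_eq\<close>).  This turns both bounds into statements about sets of vertices.

  Lower bound.  Let \<open>(I : f) = P\<close> be prime with \<open>f\<close> homogeneous of degree \<open>d\<close>.  As \<open>P\<close> contains
  every product over some \<open>N[v]\<close>, the set \<open>C\<close> of variables lying in \<open>P\<close> meets every \<open>N[v]\<close>, that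
  is, \<open>C\<close> is a dominating set.  Some monomial of \<open>f\<close> is not in \<open>I\<close>; its support \<open>D\<close> has at most
  \<open>d\<close> elements and contains no \<open>N[v]\<close>, but for each \<open>c \<in> C\<close> the set \<open>insert c D\<close> contains one,
  since \<open>t_c f \<in> I\<close>.  The set \<open>D\<close> itself need not dominate the graph, but an exchange between
  \<open>C\<close> and \<open>D\<close> yields a dominating set of at most \<open>card D\<close> vertices
  (\<open>domination_number_le_card\<close>).  The exchange relies on every vertex having a neighbor, which
  connectedness guarantees for at least two vertices.

  Upper bound.  For a vertex cover \<open>C\<close> of minimum size take \<open>f = t_C\<close>.  No \<open>N[v]\<close> is
  contained in \<open>C\<close>, since otherwise \<open>v\<close> could be removed from the cover, and the neighbors of
  a vertex \<open>w \<notin> C\<close> all lie in \<open>C\<close>, so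
  \<open>N[w] \<subseteq> insert w C\<close>.  Hence \<open>(I : f)\<close> is generated by the variables outside \<open>C\<close>
  (\<open>colon_ideal_var_prod\<close>), which is a prime ideal (\<open>primeideal_variables\<close>).
\<close>

section \<open>Products of polynomials and their monomials\<close>

text \<open>
  All terms but one vanish in the convolution; by cancellation \<open>l = a\<close> forces \<open>q = b\<close>.  Over an
  integral domain this exhibits monomials of a product that cannot cancel.
\<close>

lemma lookup_mult_unique_sum:
  fixes f g :: "'a::cancel_comm_monoid_add \<Rightarrow>\<^sub>0 'b::comm_semiring_0"
  assumes uniq: "\<And>l q. l \<in> Poly_Mapping.keys f \<Longrightarrow> q \<in> Poly_Mapping.keys g \<Longrightarrow>
      l + q = a + b \<Longrightarrow> l = a"
  shows "Poly_Mapping.lookup (f * g) (a + b)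
    = Poly_Mapping.lookup f a * Poly_Mapping.lookup g b"
proof -
  have "Poly_Mapping.lookup f l * (\<Sum>q. Poly_Mapping.lookup g q when a + b = l + q)
      = (Poly_Mapping.lookup f a * Poly_Mapping.lookup g b when l = a)" for l
  proof (cases "l = a")
    case True
    have "(a + b = a + q) = (q = b)" for q by auto
    then show ?thesis using True by simp
  next
    case False
    show ?thesis
    proof (cases "l \<in> Poly_Mapping.keys f")
      case True
      have "(Poly_Mapping.lookup g q when a + b = l + q) = 0" for q
        using uniq[OF True, of q] False
        by (cases "Poly_Mapping.lookup g q = 0") (auto simp: when_def in_keys_iff)
      then show ?thesis using False by simp
    next
      case False': False
      then show ?thesis using False by (simp add: in_keys_iff)
    qed
  qed
  then show ?thesis by (simp add: lookup_mult)
qed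

lemma keys_single_mult:
  fixes f :: "'a::cancel_comm_monoid_add \<Rightarrow>\<^sub>0 'b::comm_semiring_1"
  shows "Poly_Mapping.keys (Poly_Mapping.single k 1 * f) = (+) k ` Poly_Mapping.keys f"
proof -
  have lk: "Poly_Mapping.lookup (Poly_Mapping.single k 1 * f) (k + m) = Poly_Mapping.lookup f m" for m
    by (subst lookup_mult_unique_sum) (auto split: if_splits)
  show ?thesis
  proof
    show "Poly_Mapping.keys (Poly_Mapping.single k 1 * f) \<subseteq> (+) k ` Poly_Mapping.keys f"
      using keys_mult[of "Poly_Mapping.single k 1" f] by (auto split: if_splits)
    show "(+) k ` Poly_Mapping.keys f \<subseteq> Poly_Mapping.keys (Poly_Mapping.single k 1 * f)"
      using lk by (auto simp: in_keys_iff)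
  qed
qed

lemma keys_add_nat:
  fixes m m' :: "'v \<Rightarrow>\<^sub>0 nat"
  shows "Poly_Mapping.keys (m + m') = Poly_Mapping.keys m \<union> Poly_Mapping.keys m'"
  by (auto simp: in_keys_iff lookup_add)

text \<open>
  Monomials in finitely many variables embed additively into the monomials over \<open>nat\<close>, which carry
  a linear order compatible with addition; the sum of the two largest elements is then attained
  only once.  The detour is needed because the variables themselves are not ordered.
\<close>

lemma unique_sum_exists:
  fixes A B :: "('v::finite \<Rightarrow>\<^sub>0 nat) set"
  assumes "finite A" "A \<noteq> {}" "finite B" "B \<noteq> {}"
  shows "\<exists>a\<in>A. \<exists>b\<in>B. \<forall>a'\<in>A. \<forall>b'\<in>B. a' + b' = a + b \<longrightarrow> a' = a"
proof -
  obtain idx :: "'v \<Rightarrow> nat" where idx: "inj idx"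
    using finite_imp_inj_to_nat_seg[of "UNIV :: 'v set"] by auto
  define e :: "('v \<Rightarrow>\<^sub>0 nat) \<Rightarrow> (nat \<Rightarrow>\<^sub>0 nat)" where
    "e m = (\<Sum>v\<in>UNIV. Poly_Mapping.single (idx v) (Poly_Mapping.lookup m v))" for m
  have add: "e (m + m') = e m + e m'" for m m'
    by (simp add: e_def lookup_add single_add sum.distrib)
  have "Poly_Mapping.lookup (e m) (idx v) = Poly_Mapping.lookup m v" for m v
    using idx by (simp add: e_def lookup_sum lookup_single when_def inj_eq)
  then have inj: "m = m'" if "e m = e m'" for m m'
    using that by (metis poly_mapping_eqI)
  have "Max (e ` A) \<in> e ` A" "Max (e ` B) \<in> e ` B"
    using assms by simp_all
  then obtain a b where ab: "a \<in> A" "e a = Max (e ` A)" "b \<in> B" "e b = Max (e ` B)"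
    by force
  have "a' = a" if "a' \<in> A" "b' \<in> B" "a' + b' = a + b" for a' b'
  proof -
    have le: "e a' \<le> e a" "e b' \<le> e b" using ab that assms by simp_all
    have "e a' + e b' = e a + e b" using that(3) by (metis add)
    then have "\<not> e a' < e a" using add_less_le_mono[OF _ le(2)] by fastforce
    then show ?thesis using le inj by (simp add: order.not_eq_order_implies_strict)
  qed
  then show ?thesis using ab by blast
qed

section \<open>Squarefree monomial ideals\<close>

lemma poly_ring_simps [simp]:
  "carrier poly_ring = UNIV" "mult poly_ring = (*)" "one poly_ring = 1"
  "zero poly_ring = 0" "add poly_ring = (+)"
  by (simp_all add: poly_ring_def)

lemma cring_poly_ring: "cring (poly_ring :: ('v, 'k::field) mpoly ring)"
proof (rule cringI)
  show "abelian_group (poly_ring :: ('v, 'k) mpoly ring)"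
  proof (rule abelian_groupI)
    fix x :: "('v, 'k) mpoly"
    show "\<exists>y\<in>carrier poly_ring. y \<oplus>\<^bsub>poly_ring\<^esub> x = \<zero>\<^bsub>poly_ring\<^esub>"
      by (auto intro: exI[of _ "- x"])
  qed (simp_all add: algebra_simps)
  show "Group.comm_monoid (poly_ring :: ('v, 'k) mpoly ring)"
    by unfold_locales (simp_all add: algebra_simps)
qed (simp add: algebra_simps)

lemma ideal_poly_ringI:
  fixes J :: "('v, 'k::field) mpoly set"
  assumes "0 \<in> J" "\<And>f g. f \<in> J \<Longrightarrow> g \<in> J \<Longrightarrow> f + g \<in> J" "\<And>f g. f \<in> J \<Longrightarrow> g * f \<in> J"
  shows "ideal J poly_ring"
proof -
  interpret cring "poly_ring :: ('v, 'k) mpoly ring" by (rule cring_poly_ring)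
  have "\<ominus>\<^bsub>poly_ring\<^esub> f = - f" for f :: "('v, 'k) mpoly"
    by (rule minus_equality) simp_all
  then have neg: "\<ominus>\<^bsub>poly_ring\<^esub> f \<in> J" if "f \<in> J" for f
    using assms(3)[OF that, of "- 1"] by simp
  show ?thesis
  proof (rule idealI)
    show "subgroup J (add_monoid (poly_ring :: ('v, 'k) mpoly ring))"
      by (rule add.subgroupI)
        (use assms neg in \<open>auto simp: a_inv_def[symmetric]\<close>)
  qed (use assms in \<open>auto simp: mult.commute ring_axioms\<close>)
qed

text \<open>
  The squarefree monomial ideal of a hypergraph with edge set \<open>F\<close>, described by the supports of
  monomials instead of by generators.
\<close>

definition edge_ideal :: "'v set set \<Rightarrow> ('v, 'k::field) mpoly set" where
  "edge_ideal F = {f. \<forall>m\<in>Poly_Mapping.keys f. \<exists>A\<in>F. A \<subseteq> Poly_Mapping.keys m}"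

lemma ideal_edge_ideal: "ideal (edge_ideal F :: ('v, 'k::field) mpoly set) poly_ring"
proof (rule ideal_poly_ringI)
  fix f g :: "('v, 'k) mpoly"
  assume f: "f \<in> edge_ideal F"
  show "g * f \<in> edge_ideal F"
    unfolding edge_ideal_def
  proof clarify
    fix m assume "m \<in> Poly_Mapping.keys (g * f)"
    then obtain a b where ab: "m = a + b" "b \<in> Poly_Mapping.keys f"
      using keys_mult[of g f] by blast
    then obtain A where "A \<in> F" "A \<subseteq> Poly_Mapping.keys b"
      using f unfolding edge_ideal_def by blast
    then show "\<exists>A\<in>F. A \<subseteq> Poly_Mapping.keys m"
      unfolding ab(1) keys_add_nat by blast
  qed
  assume "g \<in> edge_ideal F"
  then show "f + g \<in> edge_ideal F"
    using f keys_add[of f g] unfolding edge_ideal_def by blast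
qed (simp add: edge_ideal_def)

definition squarefree_monomial :: "'v set \<Rightarrow> ('v \<Rightarrow>\<^sub>0 nat)" where
  "squarefree_monomial A = (\<Sum>v\<in>A. Poly_Mapping.single v 1)"

lemma lookup_squarefree_monomial:
  fixes A :: "'v::finite set"
  shows "Poly_Mapping.lookup (squarefree_monomial A) v = of_bool (v \<in> A)"
  by (simp add: squarefree_monomial_def lookup_sum lookup_single when_def)

lemma keys_squarefree_monomial:
  fixes A :: "'v::finite set"
  shows "Poly_Mapping.keys (squarefree_monomial A) = A"
  by (auto simp: in_keys_iff lookup_squarefree_monomial)

lemma var_prod_eq_single:
  fixes A :: "'v::finite set"
  shows "(var_prod A :: ('v, 'k::field) mpoly) = Poly_Mapping.single (squarefree_monomial A) 1"
  using finite[of A]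
  by (induction A rule: finite_induct)
    (simp_all add: var_prod_def var_def squarefree_monomial_def mult_single)

lemma var_prod_in_edge_ideal_iff:
  fixes A :: "'v::finite set"
  shows "(var_prod A :: ('v, 'k::field) mpoly) \<in> edge_ideal F \<longleftrightarrow> (\<exists>B\<in>F. B \<subseteq> A)"
  by (simp add: edge_ideal_def var_prod_eq_single keys_squarefree_monomial)

lemma sum_single_lookup:
  "(\<Sum>m\<in>Poly_Mapping.keys f. Poly_Mapping.single m (Poly_Mapping.lookup f m)) = f"
  by (rule poly_mapping_eqI) (auto simp: lookup_sum lookup_single when_def in_keys_iff)

text \<open>
  A polynomial is the sum of its terms, and a term whose support contains \<open>A\<close> is a multiple of
  the product over \<open>A\<close>.
\<close>

lemma Idl_var_prod_eq:
  fixes F :: "'v::finite set set"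
  shows "Idl\<^bsub>poly_ring\<^esub> (var_prod ` F) = (edge_ideal F :: ('v, 'k::field) mpoly set)"
proof
  interpret cring "poly_ring :: ('v, 'k) mpoly ring" by (rule cring_poly_ring)
  let ?J = "Idl\<^bsub>poly_ring\<^esub> (var_prod ` F) :: ('v, 'k) mpoly set"
  show "?J \<subseteq> edge_ideal F"
    by (rule genideal_minimal[OF ideal_edge_ideal])
      (auto simp: var_prod_in_edge_ideal_iff)
  interpret J: ideal ?J poly_ring by (rule genideal_ideal) simp
  show "edge_ideal F \<subseteq> ?J"
  proof
    fix f :: "('v, 'k) mpoly" assume f: "f \<in> edge_ideal F"
    have terms: "Poly_Mapping.single m c \<in> ?J" if "m \<in> Poly_Mapping.keys f" for m c
    proof -
      obtain A where A: "A \<in> F" "A \<subseteq> Poly_Mapping.keys m"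
        using f \<open>m \<in> Poly_Mapping.keys f\<close> unfolding edge_ideal_def by blast
      have "(m - squarefree_monomial A) + squarefree_monomial A = m"
        using A(2) by (intro poly_mapping_eqI)
          (auto simp: lookup_add lookup_minus lookup_squarefree_monomial in_keys_iff)
      then have "Poly_Mapping.single (m - squarefree_monomial A) c * var_prod A
          = Poly_Mapping.single m c"
        by (simp add: var_prod_eq_single mult_single)
      moreover have "var_prod A \<in> ?J"
        using A(1) genideal_self[of "var_prod ` F"] by auto
      ultimately show ?thesis by (metis J.I_l_closed UNIV_I poly_ring_simps(1,2))
    qed
    have "(\<Sum>m\<in>S. Poly_Mapping.single m (Poly_Mapping.lookup f m)) \<in> ?J"
      if "finite S" "S \<subseteq> Poly_Mapping.keys f" for S
      using that
    proof (induction S rule: finite_induct)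
      case empty
      show ?case using J.zero_closed by simp
    next
      case (insert m S)
      then show ?case using J.a_closed terms by simp
    qed
    then show "f \<in> ?J"
      using sum_single_lookup[of f] by (metis finite_keys order_refl)
  qed
qed

text \<open>
  Discard from each factor the monomials involving a variable of \<open>W\<close>.  If something remains in both
  factors, a monomial arising only once as a product of remaining monomials survives in the
  product, and no discarded monomial can contribute to it.
\<close>

lemma primeideal_variables:
  fixes W :: "'v::finite set"
  shows "primeideal (edge_ideal ((\<lambda>w. {w}) ` W) :: ('v, 'k::field) mpoly set) poly_ring"
proof (rule primeidealI[OF ideal_edge_ideal cring_poly_ring])
  let ?Q = "edge_ideal ((\<lambda>w. {w}) ` W) :: ('v, 'k::field) mpoly set"
  have mem: "f \<in> ?Q \<longleftrightarrow> (\<forall>m\<in>Poly_Mapping.keys f. Poly_Mapping.keys m \<inter> W \<noteq> {})" for f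
    unfolding edge_ideal_def by auto
  have "1 \<notin> ?Q" by (simp add: mem)
  then show "carrier poly_ring \<noteq> ?Q" by auto
  fix f g :: "('v, 'k) mpoly"
  assume "f \<otimes>\<^bsub>poly_ring\<^esub> g \<in> ?Q"
  then have fg: "f * g \<in> ?Q" by simp
  show "f \<in> ?Q \<or> g \<in> ?Q"
  proof (rule ccontr)
    assume neg: "\<not> (f \<in> ?Q \<or> g \<in> ?Q)"
    define A where "A = {m\<in>Poly_Mapping.keys f. Poly_Mapping.keys m \<inter> W = {}}"
    define B where "B = {m\<in>Poly_Mapping.keys g. Poly_Mapping.keys m \<inter> W = {}}"
    have "finite A" "A \<noteq> {}" "finite B" "B \<noteq> {}"
      using neg by (auto simp: mem A_def B_def)
    then obtain a b where ab: "a \<in> A" "b \<in> B"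
      and uniq: "\<And>a' b'. a' \<in> A \<Longrightarrow> b' \<in> B \<Longrightarrow> a' + b' = a + b \<Longrightarrow> a' = a"
      using unique_sum_exists[of A B] by blast
    have disj: "Poly_Mapping.keys (a + b) \<inter> W = {}"
      using ab by (auto simp: A_def B_def keys_add_nat)
    have "Poly_Mapping.lookup (f * g) (a + b)
        = Poly_Mapping.lookup f a * Poly_Mapping.lookup g b"
    proof (rule lookup_mult_unique_sum)
      fix l q
      assume lq: "l \<in> Poly_Mapping.keys f" "q \<in> Poly_Mapping.keys g" "l + q = a + b"
      have "(Poly_Mapping.keys l \<union> Poly_Mapping.keys q) \<inter> W = {}"
        using disj unfolding lq(3)[symmetric] keys_add_nat .
      then show "l = a"
        using lq by (intro uniq) (auto simp: A_def B_def)
    qed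
    also have "\<dots> \<noteq> 0"
      using ab by (simp add: A_def B_def in_keys_iff)
    finally show False
      using fg disj by (auto simp: mem in_keys_iff)
  qed
qed

text \<open>
  Multiplying by the product over \<open>C\<close> enlarges the support of every monomial by \<open>C\<close>.  The
  hypotheses say that \<open>C\<close> is a maximal set containing no member of \<open>F\<close>.
\<close>

lemma colon_ideal_var_prod:
  fixes C :: "'v::finite set"
  assumes indep: "\<And>A. A \<in> F \<Longrightarrow> \<not> A \<subseteq> C"
    and maximal: "\<And>w. w \<notin> C \<Longrightarrow> \<exists>A\<in>F. A \<subseteq> insert w C"
  shows "colon_ideal poly_ring (edge_ideal F) (var_prod C)
    = (edge_ideal ((\<lambda>w. {w}) ` (- C)) :: ('v, 'k::field) mpoly set)"
proof -
  have supp: "(\<exists>A\<in>F. A \<subseteq> C \<union> M) \<longleftrightarrow> (\<exists>w\<in>- C. {w} \<subseteq> M)" for M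
  proof
    assume "\<exists>A\<in>F. A \<subseteq> C \<union> M"
    then show "\<exists>w\<in>- C. {w} \<subseteq> M" using indep by blast
  next
    assume "\<exists>w\<in>- C. {w} \<subseteq> M"
    then obtain w where "w \<notin> C" "w \<in> M" by blast
    then show "\<exists>A\<in>F. A \<subseteq> C \<union> M" using maximal[of w] by blast
  qed
  have "g * var_prod C \<in> edge_ideal F \<longleftrightarrow> g \<in> edge_ideal ((\<lambda>w. {w}) ` (- C))"
    for g :: "('v, 'k) mpoly"
    unfolding edge_ideal_def mult.commute[of g] var_prod_eq_single
    by (simp add: keys_single_mult keys_add_nat keys_squarefree_monomial supp)
  then show ?thesis by (auto simp: colon_ideal_def)
qed

section \<open>Colon ideals and associated primes\<close>

text \<open>\<open>(I : f)\<close> is the annihilator of the residue class of \<open>f\<close>.\<close>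

lemma primeideal_colon_associated:
  assumes "ideal I R" "f \<in> carrier R" "primeideal (colon_ideal R I f) R"
  shows "colon_ideal R I f \<in> associated_primes R I"
proof -
  interpret ideal I R by fact
  have "(I +>\<^bsub>R\<^esub> r) \<otimes>\<^bsub>R Quot I\<^esub> (I +>\<^bsub>R\<^esub> f) = \<zero>\<^bsub>R Quot I\<^esub> \<longleftrightarrow> r \<otimes>\<^bsub>R\<^esub> f \<in> I"
    if "r \<in> carrier R" for r
  proof -
    have "(I +>\<^bsub>R\<^esub> r) \<otimes>\<^bsub>R Quot I\<^esub> (I +>\<^bsub>R\<^esub> f) = I +>\<^bsub>R\<^esub> (r \<otimes>\<^bsub>R\<^esub> f)"
      using that assms(2) by (simp add: FactRing_def rcoset_mult_add)
    moreover have "I +>\<^bsub>R\<^esub> x = I \<longleftrightarrow> x \<in> I" if "x \<in> carrier R" for x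
      using that a_rcos_const a_rcos_self by blast
    ultimately show ?thesis using that assms(2) by (simp add: FactRing_def)
  qed
  then have "colon_ideal R I f = {r \<in> carrier R.
      (I +>\<^bsub>R\<^esub> r) \<otimes>\<^bsub>R Quot I\<^esub> (I +>\<^bsub>R\<^esub> f) = \<zero>\<^bsub>R Quot I\<^esub>}"
    by (auto simp: colon_ideal_def)
  moreover have "I +>\<^bsub>R\<^esub> f \<in> carrier (R Quot I)"
    using assms(2) by (simp add: FactRing_def a_rcosetsI a_subset)
  ultimately show ?thesis
    using assms(3) unfolding associated_primes_def by blast
qed

lemma primeideal_var_prod:
  fixes P :: "('v, 'k::field) mpoly set"
  assumes P: "primeideal P poly_ring" and "finite A" "var_prod A \<in> P"
  shows "\<exists>v\<in>A. var v \<in> P"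
  using assms(2,3)
proof (induction A rule: finite_induct)
  case empty
  interpret primeideal P poly_ring by (rule P)
  have "1 \<notin> P" using I_notcarr one_imp_carrier by auto
  then show ?case using empty by (simp add: var_prod_def)
next
  case (insert v A)
  interpret primeideal P poly_ring by (rule P)
  have "var v * var_prod A \<in> P" using insert by (simp add: var_prod_def)
  then have "var v \<in> P \<or> var_prod A \<in> P" using I_prime by simp
  then show ?case using insert by blast
qed

lemma card_keys_le_degree:
  fixes m :: "'v::finite \<Rightarrow>\<^sub>0 nat"
  shows "card (Poly_Mapping.keys m) \<le> (\<Sum>v\<in>UNIV. Poly_Mapping.lookup m v)"
proof -
  have "card (Poly_Mapping.keys m) = (\<Sum>v\<in>Poly_Mapping.keys m. 1)" by simp
  also have "\<dots> \<le> (\<Sum>v\<in>Poly_Mapping.keys m. Poly_Mapping.lookup m v)"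
    by (rule sum_mono) (simp add: in_keys_iff)
  also have "\<dots> \<le> (\<Sum>v\<in>UNIV. Poly_Mapping.lookup m v)"
    by (rule sum_mono2) auto
  finally show ?thesis .
qed

lemma var_prod_homogeneous:
  fixes C :: "'v::finite set"
  shows "(var_prod C :: ('v, 'k::field) mpoly) \<in> homogeneous_part (card C)"
  by (simp add: homogeneous_part_def var_prod_eq_single lookup_squarefree_monomial sum.If_cases of_bool_def)

section \<open>Domination and vertex covers\<close>

lemma domination_number_le:
  fixes E :: "'v::finite \<Rightarrow> 'v \<Rightarrow> bool"
  assumes "dominating_set E D"
  shows "domination_number E \<le> card D"
  unfolding domination_number_def using assms by (intro Min_le) auto

lemma vertex_cover_number_le:
  fixes E :: "'v::finite \<Rightarrow> 'v \<Rightarrow> bool"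
  assumes "vertex_cover E C"
  shows "vertex_cover_number E \<le> card C"
  unfolding vertex_cover_number_def using assms by (intro Min_le) auto

lemma vertex_cover_number_attained:
  fixes E :: "'v::finite \<Rightarrow> 'v \<Rightarrow> bool"
  obtains C where "vertex_cover E C" "card C = vertex_cover_number E"
proof -
  have "vertex_cover E UNIV" by (simp add: vertex_cover_def)
  then have "vertex_cover_number E \<in> {card C | C. vertex_cover E C}"
    unfolding vertex_cover_number_def by (intro Min_in) auto
  then show ?thesis using that by auto
qed

text \<open>
  Each \<open>c \<in> C\<close> is the only vertex outside \<open>D\<close> of some \<open>N[v]\<close>, where \<open>v \<in> D\<close> or \<open>v = c\<close>.  If \<open>v\<close> can
  be chosen in \<open>D\<close>, keep \<open>c\<close> and drop \<open>v\<close> from \<open>D\<close>; this exchange does not increase the size,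
  because \<open>v\<close> determines \<open>c\<close>.  If \<open>v = c\<close> is the only choice, all neighbors of \<open>c\<close> lie in \<open>D\<close>, and
  none of them is dropped, since a dropped vertex has its only neighbor outside \<open>D\<close> among the
  kept elements of \<open>C\<close>.  So the rest of \<open>D\<close> contains all neighbors of \<open>c\<close>, and it dominates \<open>c\<close>
  because \<open>c\<close> has a neighbor.
\<close>

lemma domination_number_le_card:
  fixes E :: "'v::finite \<Rightarrow> 'v \<Rightarrow> bool"
  assumes "simple_graph E" and no_isolated: "\<And>v. \<exists>w. E v w"
    and C: "dominating_set E C"
    and indep: "\<And>v. \<not> closed_nbhd E v \<subseteq> D"
    and almost: "\<And>c. c \<in> C \<Longrightarrow> \<exists>v. closed_nbhd E v \<subseteq> insert c D"
  shows "domination_number E \<le> card D"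
proof -
  have sym: "E u v \<Longrightarrow> E v u" and irrefl: "\<not> E u u" for u v
    using assms(1) by (auto simp: simple_graph_def symp_def irreflp_def)
  define A where "A = {v\<in>D. \<exists>c\<in>C. closed_nbhd E v - D = {c}}"
  have "\<forall>v\<in>A. \<exists>c. closed_nbhd E v - D = {c}" by (auto simp: A_def)
  then obtain s where s: "\<And>v. v \<in> A \<Longrightarrow> closed_nbhd E v - D = {s v}"
    by metis
  have "dominating_set E (s ` A \<union> (D - A))"
    unfolding dominating_set_def
  proof (intro equalityI subset_UNIV subsetI)
    fix w
    obtain c where c: "c \<in> C" "w \<in> closed_nbhd E c"
      using C by (auto simp: dominating_set_def)
    show "w \<in> (\<Union>v\<in>s ` A \<union> (D - A). closed_nbhd E v)"
    proof (cases "c \<in> s ` A")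
      case True
      then show ?thesis using c by blast
    next
      case False
      obtain v where "closed_nbhd E v \<subseteq> insert c D" using almost c by blast
      then have v: "closed_nbhd E v - D = {c}" using indep[of v] by blast
      have "v \<notin> D"
      proof
        assume "v \<in> D"
        then have "v \<in> A" using v c by (auto simp: A_def)
        then have "s v = c" using s v by auto
        then show False using False \<open>v \<in> A\<close> by auto
      qed
      then have "v = c" using v by (auto simp: closed_nbhd_def)
      have nbr: "u \<in> D - A" if "E c u" for u
      proof -
        have "u \<in> D"
          using that v irrefl[of c] unfolding \<open>v = c\<close> closed_nbhd_def by auto
        moreover have "u \<notin> A"
        proof
          assume "u \<in> A"
          moreover have "c \<in> closed_nbhd E u - D"
            using sym[OF that] v by (auto simp: closed_nbhd_def)
          ultimately show False using False s[of u] by auto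
        qed
        ultimately show ?thesis by simp
      qed
      show ?thesis
      proof (cases "w = c")
        case True
        obtain u where "E c u" using no_isolated by blast
        then show ?thesis using nbr[of u] sym True by (auto simp: closed_nbhd_def)
      next
        case False
        then have "w \<in> D - A" using c nbr by (auto simp: closed_nbhd_def)
        then show ?thesis by (auto simp: closed_nbhd_def)
      qed
    qed
  qed
  then have "domination_number E \<le> card (s ` A \<union> (D - A))"
    by (rule domination_number_le)
  also have "\<dots> \<le> card A + card (D - A)"
    by (meson add_mono card_Un_le card_image_le finite le_refl order_trans)
  also have "\<dots> = card D"
    using card_Un_disjoint[of A "D - A"] by (auto simp: A_def Un_absorb1 subset_iff)
  finally show ?thesis .
qed

section \<open>Bounds on the v-number\<close>

lemma closed_nbhd_ideal_eq:
  "(closed_nbhd_ideal E :: ('v::finite, 'k::field) mpoly set) = edge_ideal (range (closed_nbhd E))"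
  unfolding closed_nbhd_ideal_def Idl_var_prod_eq[symmetric] by (simp add: image_image)

lemma domination_number_le_degree:
  fixes E :: "'v::finite \<Rightarrow> 'v \<Rightarrow> bool"
  assumes "simple_graph E" "\<And>v. \<exists>w. E v w"
    and f: "(f :: ('v, 'k::field) mpoly) \<in> homogeneous_part d"
    and prime: "primeideal (colon_ideal poly_ring (closed_nbhd_ideal E) f) poly_ring"
  shows "domination_number E \<le> d"
proof -
  let ?I = "edge_ideal (range (closed_nbhd E)) :: ('v, 'k) mpoly set"
  let ?P = "colon_ideal poly_ring ?I f"
  interpret I: ideal ?I poly_ring by (rule ideal_edge_ideal)
  have P: "primeideal ?P poly_ring" using prime by (simp add: closed_nbhd_ideal_eq)
  have memP: "g \<in> ?P \<longleftrightarrow> g * f \<in> ?I" for g by (simp add: colon_ideal_def)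
  have "f \<notin> ?I"
  proof
    assume "f \<in> ?I"
    then have "?P = UNIV" using memP I.I_l_closed by force
    then show False using primeideal.I_notcarr[OF P] by simp
  qed
  then obtain m where m: "m \<in> Poly_Mapping.keys f"
    and indep: "\<And>v. \<not> closed_nbhd E v \<subseteq> Poly_Mapping.keys m"
    by (auto simp: edge_ideal_def)
  define C where "C = {v. var v \<in> ?P}"
  have "dominating_set E C"
    unfolding dominating_set_def
  proof (intro equalityI subset_UNIV subsetI)
    fix w
    have "(var_prod (closed_nbhd E w) :: ('v, 'k) mpoly) \<in> ?I"
      by (auto simp: var_prod_in_edge_ideal_iff)
    then have "var_prod (closed_nbhd E w) \<in> ?P"
      using memP I.I_r_closed by simp
    then obtain c where "c \<in> closed_nbhd E w" "var c \<in> ?P"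
      using primeideal_var_prod[OF P, of "closed_nbhd E w"] by auto
    moreover from this(1) have "w \<in> closed_nbhd E c"
      using assms(1) by (auto simp: closed_nbhd_def simple_graph_def symp_def)
    ultimately show "w \<in> (\<Union>v\<in>C. closed_nbhd E v)" by (auto simp: C_def)
  qed
  moreover have "\<exists>v. closed_nbhd E v \<subseteq> insert c (Poly_Mapping.keys m)" if "c \<in> C" for c
  proof -
    have "var c * f \<in> ?I" using that memP by (simp add: C_def)
    moreover have "Poly_Mapping.single c 1 + m \<in> Poly_Mapping.keys (var c * f)"
      using m by (simp add: var_def keys_single_mult)
    ultimately obtain v where "closed_nbhd E v \<subseteq> Poly_Mapping.keys (Poly_Mapping.single c 1 + m)"
      unfolding edge_ideal_def by blast
    then show ?thesis by (auto simp: keys_add_nat)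
  qed
  ultimately have "domination_number E \<le> card (Poly_Mapping.keys m)"
    using domination_number_le_card[OF assms(1,2)] indep by blast
  also have "\<dots> \<le> d"
    using card_keys_le_degree[of m] f m by (auto simp: homogeneous_part_def)
  finally show ?thesis .
qed

lemma minimum_vertex_cover_colon_associated:
  fixes E :: "'v::finite \<Rightarrow> 'v \<Rightarrow> bool"
  assumes "simple_graph E" and C: "vertex_cover E C" "card C = vertex_cover_number E"
  shows "colon_ideal poly_ring (closed_nbhd_ideal E) (var_prod C)
    \<in> associated_primes poly_ring (closed_nbhd_ideal E :: ('v, 'k::field) mpoly set)"
proof -
  have sym: "E u v \<Longrightarrow> E v u" for u v
    using assms(1) by (auto simp: simple_graph_def symp_def)
  have "\<not> closed_nbhd E v \<subseteq> C" for v
  proof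
    assume sub: "closed_nbhd E v \<subseteq> C"
    then have "vertex_cover E (C - {v})"
      using C(1) sym assms(1)
      by (auto simp: vertex_cover_def closed_nbhd_def subset_iff simple_graph_def irreflp_def)
    then have "card C \<le> card (C - {v})" using vertex_cover_number_le C(2) by metis
    moreover have "v \<in> C" using sub by (simp add: closed_nbhd_def)
    ultimately show False using card_Diff1_less[of C v] by simp
  qed
  moreover have "closed_nbhd E w \<subseteq> insert w C" if "w \<notin> C" for w
    using that C(1) by (auto simp: vertex_cover_def closed_nbhd_def)
  ultimately have "colon_ideal poly_ring (edge_ideal (range (closed_nbhd E))) (var_prod C)
      = (edge_ideal ((\<lambda>w. {w}) ` (- C)) :: ('v, 'k) mpoly set)"
    by (intro colon_ideal_var_prod) blast+
  then show ?thesis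
    unfolding closed_nbhd_ideal_eq
    by (intro primeideal_colon_associated ideal_edge_ideal) (simp_all add: primeideal_variables)
qed

lemma connected_graph_no_isolated:
  fixes E :: "'v::finite \<Rightarrow> 'v \<Rightarrow> bool"
  assumes "connected_graph E" "card (UNIV :: 'v set) \<ge> 2"
  shows "\<exists>w. E v w"
proof -
  have "\<exists>u. u \<noteq> v"
  proof (rule ccontr)
    assume "\<nexists>u. u \<noteq> v"
    then have "(UNIV :: 'v set) = {v}" by auto
    then have "card (UNIV :: 'v set) = card {v}" by (rule arg_cong)
    then show False using assms(2) by simp
  qed
  then obtain u where "u \<noteq> v" by blast
  then show ?thesis
    using assms(1) unfolding connected_graph_def by (metis converse_rtranclpE)
qed

theorem theorem4p1:
  fixes E :: "'v::finite \<Rightarrow> 'v \<Rightarrow> bool"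
  assumes "simple_graph E"
    and "connected_graph E"
    and "card (UNIV :: 'v set) \<ge> 2"
  shows "domination_number E
           \<le> v_number (closed_nbhd_ideal E :: ('v, 'k::field) mpoly set)
       \<and> v_number (closed_nbhd_ideal E :: ('v, 'k::field) mpoly set)
           \<le> vertex_cover_number E"
proof -
  let ?I = "closed_nbhd_ideal E :: ('v, 'k) mpoly set"
  define T where "T = {d. \<exists>f \<in> homogeneous_part d. \<exists>P \<in> associated_primes poly_ring ?I.
     colon_ideal poly_ring ?I f = P}"
  have v: "v_number ?I = Inf T" by (simp add: v_number_def T_def)
  obtain C where C: "vertex_cover E C" "card C = vertex_cover_number E"
    by (rule vertex_cover_number_attained)
  have tau: "vertex_cover_number E \<in> T"
    using minimum_vertex_cover_colon_associated[OF assms(1) C] var_prod_homogeneous[of C] C(2)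
    unfolding T_def by auto
  \<comment> \<open>As \<open>T\<close> is nonempty, its infimum is the degree of an actual witness.\<close>
  have "Inf T \<in> T" using tau by (intro Inf_nat_def1) auto
  then obtain f :: "('v, 'k) mpoly" where f: "f \<in> homogeneous_part (Inf T)"
    and "colon_ideal poly_ring ?I f \<in> associated_primes poly_ring ?I"
    by (auto simp: T_def)
  then have "primeideal (colon_ideal poly_ring ?I f) poly_ring"
    by (simp add: associated_primes_def)
  with f have "domination_number E \<le> Inf T"
    by (rule domination_number_le_degree[OF assms(1) connected_graph_no_isolated[OF assms(2,3)]])
  moreover have "Inf T \<le> vertex_cover_number E"
    using tau by (rule cInf_lower) simp
  ultimately show ?thesis by (simp add: v)
qed

end
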